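(* Let $p\ge5$ be prime, $n=d=p-1$, and define $\phi_\star\in\mathbb R^{\mathbb F_p^\times}$ by $$\phi_\star(1)=\frac{1+\sqrt n}{\sqrt{2n+2\sqrt n}},\qquad\phi_\star(m)=\frac1{\sqrt{2n+2\sqrt n}}\quad(m\ne1).$$ Then, for every $A\in\mathbb C^{\mathbb F_p^\times\times\mathbb F_p^\times}$, $$\|\mathcal M_{\phi_\star}(A)\|_{\ell^2(G)}\ge\frac{\sqrt p}{\sqrt n+1}\,\sin\!\Big(\frac{\pi}{2n}\Big)\|A\|_F.$$ In particular, the inverse of $\mathcal M_{\phi_\star}$ on its range has norm at most $2d$. Conversely, there is a nonzero $A$ such that $$\|\mathcal M_{\phi_\star}(A)\|_{\ell^2(G)}\le\frac{\pi\sqrt{5p/2}}{2n(\sqrt n+1)}\|A\|_F.$$ Thus the least singular value of $\mathcal M_{\phi_\star}$ is of order $d^{-1}$ (bounded above and below by absolute positive constants times $d^{-1}$).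
   Context: $G=\mathbb F_p\rtimes\mathbb F_p^\times$ is the affine group with product $(k,l)(k',l')=(k+lk',ll')$, acting on $\mathbb C^{\mathbb F_p^\times}$ by the unitary representation $(\pi(k,l)f)(m)=e_p(km)f(lm)$, where $e_p(x)=\exp(2\pi i x/p)$. For a vector $\phi$, $\mathcal M_\phi:\mathbb C^{\mathbb F_p^\times\times\mathbb F_p^\times}\to\mathbb C^G$ is the linear map $\mathcal M_\phi(A)(g)=\langle A\pi(g)\phi,\pi(g)\phi\rangle$. $\|\cdot\|_F$ is the Frobenius norm, $\ell^2(G)$ uses counting measure, and the least singular value of $\mathcal M_\phi$ is $\min_{A\ne0}\|\mathcal M_\phi(A)\|_{\ell^2(G)}/\|A\|_F$. *)

theory Defs
  imports "HOL-Analysis.Analysis" "HOL-Number_Theory.Residues"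
begin

(* F_p is residue_ring (int p), with carrier {0..p-1}, and F_p^* is its set of Units. *)

abbreviation Fp :: "nat \<Rightarrow> int ring" where
  "Fp p \<equiv> residue_ring (int p)"

abbreviation Fpx :: "nat \<Rightarrow> int set" where
  "Fpx p \<equiv> Units (Fp p)"

(* C^X is represented by the functions on the ambient type that vanish off X,
   so that its elements correspond one-to-one to the functions X \<rightarrow> C. *)

definition fun_space :: "'a set \<Rightarrow> ('a \<Rightarrow> complex) set" where
  "fun_space X = {f. \<forall>x. x \<notin> X \<longrightarrow> f x = 0}"

definition l2norm :: "'a set \<Rightarrow> ('a \<Rightarrow> complex) \<Rightarrow> real" where
  "l2norm X f = L2_set (\<lambda>x. cmod (f x)) X"

(* Linear in the first argument, so that matrix coefficients are linear in the matrix. *)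

definition l2inner :: "'a set \<Rightarrow> ('a \<Rightarrow> complex) \<Rightarrow> ('a \<Rightarrow> complex) \<Rightarrow> complex" where
  "l2inner X u v = (\<Sum>x\<in>X. u x * cnj (v x))"

definition affine_group :: "nat \<Rightarrow> (int \<times> int) monoid" where
  "affine_group p =
     \<lparr>carrier = carrier (Fp p) \<times> Fpx p,
      monoid.mult = (\<lambda>(k, l) (k', l'). (k \<oplus>\<^bsub>Fp p\<^esub> l \<otimes>\<^bsub>Fp p\<^esub> k', l \<otimes>\<^bsub>Fp p\<^esub> l')),
      one = (\<zero>\<^bsub>Fp p\<^esub>, \<one>\<^bsub>Fp p\<^esub>)\<rparr>"

definition add_char :: "nat \<Rightarrow> int \<Rightarrow> complex" where
  "add_char p x = exp (2 * of_real pi * \<i> * of_int x / of_nat p)"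

definition affine_rep :: "nat \<Rightarrow> int \<times> int \<Rightarrow> (int \<Rightarrow> complex) \<Rightarrow> int \<Rightarrow> complex" where
  "affine_rep p = (\<lambda>(k, l) f m.
     if m \<in> Fpx p then add_char p (k \<otimes>\<^bsub>Fp p\<^esub> m) * f (l \<otimes>\<^bsub>Fp p\<^esub> m) else 0)"

abbreviation mat_space :: "nat \<Rightarrow> (int \<times> int \<Rightarrow> complex) set" where
  "mat_space p \<equiv> fun_space (Fpx p \<times> Fpx p)"

definition mat_vec :: "nat \<Rightarrow> (int \<times> int \<Rightarrow> complex) \<Rightarrow> (int \<Rightarrow> complex) \<Rightarrow> int \<Rightarrow> complex" where
  "mat_vec p A f = (\<lambda>i. if i \<in> Fpx p then \<Sum>j\<in>Fpx p. A (i, j) * f j else 0)"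

definition frob_norm :: "nat \<Rightarrow> (int \<times> int \<Rightarrow> complex) \<Rightarrow> real" where
  "frob_norm p A = l2norm (Fpx p \<times> Fpx p) A"

definition meas_map ::
  "nat \<Rightarrow> (int \<Rightarrow> complex) \<Rightarrow> (int \<times> int \<Rightarrow> complex) \<Rightarrow> int \<times> int \<Rightarrow> complex" where
  "meas_map p \<phi> A = (\<lambda>g.
     if g \<in> carrier (affine_group p)
     then l2inner (Fpx p) (mat_vec p A (affine_rep p g \<phi>)) (affine_rep p g \<phi>)
     else 0)"

abbreviation norm_G :: "nat \<Rightarrow> (int \<times> int \<Rightarrow> complex) \<Rightarrow> real" where
  "norm_G p F \<equiv> l2norm (carrier (affine_group p)) F"

(* A true minimum: LEAST denotes the least element of the set of quotients, not an infimum. *)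

definition least_singular_value :: "nat \<Rightarrow> (int \<Rightarrow> complex) \<Rightarrow> real" where
  "least_singular_value p \<phi> =
     (LEAST s. s \<in> {norm_G p (meas_map p \<phi> A) / frob_norm p A |A.
                      A \<in> mat_space p \<and> A \<noteq> (\<lambda>_. 0)})"

(* Operator norm of the inverse of meas_map p \<phi>, from its range to the matrices; meaningful when
   meas_map p \<phi> is injective on the matrices. The supremum is taken in ennreal, so that it would be
   infinite for an unbounded set of quotients. *)

definition inverse_norm :: "nat \<Rightarrow> (int \<Rightarrow> complex) \<Rightarrow> ennreal" where
  "inverse_norm p \<phi> =
     (SUP F \<in> meas_map p \<phi> ` mat_space p - {\<lambda>_. 0}.
        ennreal (frob_norm p (inv_into (mat_space p) (meas_map p \<phi>) F) / norm_G p F))"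

definition phi_star :: "nat \<Rightarrow> int \<Rightarrow> real" where
  "phi_star p m =
     (let n = real (p - 1) in
      if m \<notin> Fpx p then 0
      else if m = \<one>\<^bsub>Fp p\<^esub> then (1 + sqrt n) / sqrt (2 * n + 2 * sqrt n)
      else 1 / sqrt (2 * n + 2 * sqrt n))"

abbreviation phi_star_c :: "nat \<Rightarrow> int \<Rightarrow> complex" where
  "phi_star_c p \<equiv> (\<lambda>m. complex_of_real (phi_star p m))"

lemma Fpx_eq:
  assumes "prime p"
  shows "Fpx p = {1..int p - 1}"
proof -
  interpret residues_prime p "Fp p"
    by unfold_locales (use assms in auto)
  show ?thesis
    using res_prime_units_eq prime_gt_0_nat[OF assms] by simp
qed

lemma group_affine_group:
  assumes "prime p"
  shows "group (affine_group p)"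
proof -
  interpret residues_prime p "Fp p"
    by unfold_locales (use assms in auto)
  let ?G = "affine_group p"
  let ?R = "Fp p"
  show ?thesis
  proof (rule groupI)
    fix x assume x: "x \<in> carrier ?G"
    obtain k l where kl: "x = (k, l)" "k \<in> carrier ?R" "l \<in> Units ?R"
      using x by (auto simp: affine_group_def)
    let ?l' = "inv\<^bsub>?R\<^esub> l"
    have "(\<ominus>\<^bsub>?R\<^esub> (?l' \<otimes>\<^bsub>?R\<^esub> k)) \<oplus>\<^bsub>?R\<^esub> ?l' \<otimes>\<^bsub>?R\<^esub> k = \<zero>\<^bsub>?R\<^esub>"
      by (rule l_neg) (use kl in auto)
    then show "\<exists>y\<in>carrier ?G. y \<otimes>\<^bsub>?G\<^esub> x = \<one>\<^bsub>?G\<^esub>"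
      using kl by (intro bexI[of _ "(\<ominus>\<^bsub>?R\<^esub> (?l' \<otimes>\<^bsub>?R\<^esub> k), ?l')"]) (auto simp: affine_group_def)
  next
    fix x y z assume "x \<in> carrier ?G" "y \<in> carrier ?G" "z \<in> carrier ?G"
    then show "x \<otimes>\<^bsub>?G\<^esub> y \<otimes>\<^bsub>?G\<^esub> z = x \<otimes>\<^bsub>?G\<^esub> (y \<otimes>\<^bsub>?G\<^esub> z)"
      by (auto simp: affine_group_def r_distr m_assoc a_assoc Units_closed)
  qed (auto simp: affine_group_def Units_closed)
qed

lemma add_char_mod: "p > 0 \<Longrightarrow> add_char p (x mod int p) = add_char p x"
proof -
  assume p: "p > 0"
  have "add_char p (y + int p * q) = add_char p y * exp (2 * of_int q * of_real pi * \<i>)" for y q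
    using p unfolding add_char_def
    by (simp add: exp_add [symmetric] add_divide_distrib ring_distribs mult_ac)
  from this[of "x mod int p" "x div int p"]
  have "add_char p x = add_char p (x mod int p) * exp (2 * of_int (x div int p) * of_real pi * \<i>)"
    by simp
  also have "exp (2 * of_int (x div int p) * of_real pi * \<i>) = 1"
    by (subst exp_eq_1) auto
  finally show ?thesis by simp
qed

lemma add_char_add: "add_char p (x + y) = add_char p x * add_char p y"
  by (simp add: add_char_def exp_add [symmetric] add_divide_distrib ring_distribs)

lemma affine_rep_mult:
  assumes "prime p" "g \<in> carrier (affine_group p)" "h \<in> carrier (affine_group p)"
  shows "affine_rep p (g \<otimes>\<^bsub>affine_group p\<^esub> h) f = affine_rep p g (affine_rep p h f)"
proof -
  interpret residues_prime p "Fp p"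
    by unfold_locales (use assms in auto)
  obtain k l k' l' where gh: "g = (k, l)" "h = (k', l')" "k \<in> carrier (Fp p)" "k' \<in> carrier (Fp p)"
     "l \<in> Fpx p" "l' \<in> Fpx p"
    using assms(2,3) by (auto simp: affine_group_def)
  have p: "p > 0" using assms(1) by (simp add: prime_gt_0_nat)
  show ?thesis
  proof
    fix m
    show "affine_rep p (g \<otimes>\<^bsub>affine_group p\<^esub> h) f m = affine_rep p g (affine_rep p h f) m"
    proof (cases "m \<in> Fpx p")
      case True
      have lm: "l \<otimes>\<^bsub>Fp p\<^esub> m \<in> Fpx p"
        using gh True by auto
      have "add_char p ((k \<oplus>\<^bsub>Fp p\<^esub> l \<otimes>\<^bsub>Fp p\<^esub> k') \<otimes>\<^bsub>Fp p\<^esub> m) = add_char p ((k + l * k') * m)"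
        unfolding residue_ring_def using p
        by (simp add: add_char_mod mod_simps)
      also have "\<dots> = add_char p (k * m) * add_char p (k' * (l * m))"
        by (simp add: add_char_add [symmetric] algebra_simps)
      also have "\<dots> = add_char p (k \<otimes>\<^bsub>Fp p\<^esub> m) * add_char p (k' \<otimes>\<^bsub>Fp p\<^esub> (l \<otimes>\<^bsub>Fp p\<^esub> m))"
        unfolding residue_ring_def using p
        by (simp add: add_char_mod mod_simps)
      finally have 1: "add_char p ((k \<oplus>\<^bsub>Fp p\<^esub> l \<otimes>\<^bsub>Fp p\<^esub> k') \<otimes>\<^bsub>Fp p\<^esub> m) =
        add_char p (k \<otimes>\<^bsub>Fp p\<^esub> m) * add_char p (k' \<otimes>\<^bsub>Fp p\<^esub> (l \<otimes>\<^bsub>Fp p\<^esub> m))" .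
      have 2: "l \<otimes>\<^bsub>Fp p\<^esub> l' \<otimes>\<^bsub>Fp p\<^esub> m = l' \<otimes>\<^bsub>Fp p\<^esub> (l \<otimes>\<^bsub>Fp p\<^esub> m)"
        by (simp add: residue_ring_def mod_simps mult_ac)
      show ?thesis
        using True lm unfolding gh(1,2)
        by (simp only: affine_rep_def affine_group_def monoid.simps prod.case if_True 1 2 mult.assoc)
    qed (use gh in \<open>auto simp: affine_rep_def affine_group_def\<close>)
  qed
qed

end

theory Submission
  imports Defs
begin

text \<open>
  For fixed \<open>l\<close>, the values of \<open>M A\<close> on \<open>(k, l)\<close> are a Fourier transform in \<open>k\<close> whose frequencies are the
  differences \<open>t = j - i\<close> of matrix indices. By Parseval, the squared norm of \<open>M A\<close> is \<open>p\<close> times a sum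
  of energies, one for each diagonal \<open>j - i = t\<close>. Since the vector is constant except for a peak at 1,
  each energy is explicit. Substituting \<open>i = t x\<close>, \<open>j = t (x + 1)\<close>, \<open>l = 1 / (t y)\<close>, a diagonal
  \<open>t \<noteq> 0\<close> becomes a function \<open>a\<close> on the edges of a path with \<open>n\<close> vertices, and its energy is
  \<open>1 / (4 (sqrt n + 1)\<^sup>2)\<close> times the squared norm of the unsigned incidence matrix applied to \<open>a\<close>, plus
  a nonnegative multiple of the squared modulus of the sum of \<open>a\<close>. The least eigenvalue
  \<open>4 sin\<^sup>2 (pi / (2 n))\<close> of the path gives the lower bound; an alternating tent function on the
  diagonal \<open>t = 1\<close> gives the upper bound.
\<close>

section \<open>Additive characters modulo \<open>p\<close> and Parseval\<close>

lemma carrier_affine_group: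
  assumes "prime p"
  shows "carrier (affine_group p) = {0..<int p} \<times> {1..int p - 1}"
  using Fpx_eq[OF assms] prime_gt_0_nat[OF assms]
  by (auto simp: affine_group_def residue_ring_def)

lemma add_char_cnj: "cnj (add_char p x) = add_char p (- x)"
  by (simp add: add_char_def exp_cnj)

lemma add_char_eq_1_iff:
  assumes "p > 0"
  shows "add_char p t = 1 \<longleftrightarrow> int p dvd t"
proof -
  have "add_char p t = 1 \<longleftrightarrow> (\<exists>m::int. 2 * pi * of_int t / of_nat p = of_int (2 * m) * pi)"
    by (simp add: add_char_def exp_eq_1 mult_ac)
  also have "\<dots> \<longleftrightarrow> (\<exists>m::int. real_of_int t = of_int (int p * m))"
    using assms by (simp add: field_simps)
  also have "\<dots> \<longleftrightarrow> int p dvd t"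
    unfolding of_int_eq_iff dvd_def ..
  finally show ?thesis .
qed

text \<open>Orthogonality: the terms are the powers of \<open>add_char p t\<close>, whose
  \<open>p\<close>-th power is 1, so the geometric sum vanishes unless the ratio itself is
  1.\<close>

lemma sum_add_char:
  assumes "p > 0"
  shows "(\<Sum>k\<in>{0..<int p}. add_char p (k * t)) = (if int p dvd t then of_nat p else 0)"
proof -
  have pow: "add_char p (int k * t) = add_char p t ^ k" for k
    by (induction k) (simp_all add: algebra_simps add_char_add, simp add: add_char_def)
  have "(\<Sum>k\<in>{0..<int p}. add_char p (k * t)) = (\<Sum>k<p. add_char p t ^ k)"
    by (simp flip: pow image_int_atLeastLessThan[of 0, simplified] add: sum.reindex atLeast0LessThan)
  also have "\<dots> = (if int p dvd t then of_nat p else 0)"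
  proof (cases "int p dvd t")
    case True
    then have "add_char p t = 1" using add_char_eq_1_iff[OF assms] by simp
    with True show ?thesis by simp
  next
    case False
    then have ne: "add_char p t \<noteq> 1" using add_char_eq_1_iff[OF assms] by simp
    have "add_char p t ^ p = 1"
      using add_char_eq_1_iff[OF assms, of "int p * t"] pow[of p] by simp
    with ne False show ?thesis by (simp add: geometric_sum)
  qed
  finally show ?thesis .
qed

lemma cmod_sum_power2:
  "complex_of_real ((cmod (\<Sum>q\<in>Q. f q))\<^sup>2) = (\<Sum>q\<in>Q. \<Sum>r\<in>Q. f q * cnj (f r))"
  unfolding complex_norm_square by (simp only: cnj_sum sum_product)

text \<open>Expanding the squares on the left leaves character sums over \<open>k\<close>, which
  keep only the pairs \<open>(q, r)\<close> with \<open>h q\<close> and \<open>h r\<close> congruent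
  modulo \<open>p\<close>. These are the pairs that appear when the squared fibre sums on the right
  are expanded.\<close>

lemma parseval_fibres:
  assumes p: "p > 0" and Q: "finite Q"
  shows "(\<Sum>k\<in>{0..<int p}. (cmod (\<Sum>q\<in>Q. c q * add_char p (k * h q)))\<^sup>2)
       = real p * (\<Sum>t\<in>{0..<int p}. (cmod (\<Sum>q\<in>{q\<in>Q. h q mod int p = t}. c q))\<^sup>2)"
proof -
  let ?K = "{0..<int p}"
  let ?E = "\<lambda>q r. int p dvd h q - h r"
  have K: "h q mod int p \<in> ?K" for q using p by simp
  have expand: "c q * add_char p (k * h q) * cnj (c r * add_char p (k * h r))
      = c q * cnj (c r) * add_char p (k * (h q - h r))" for k q r
    by (simp add: add_char_cnj right_diff_distrib flip: add_char_add[of p "k * h q" "- (k * h r)", simplified])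
  have "complex_of_real (\<Sum>k\<in>?K. (cmod (\<Sum>q\<in>Q. c q * add_char p (k * h q)))\<^sup>2)
      = (\<Sum>k\<in>?K. \<Sum>q\<in>Q. \<Sum>r\<in>Q. c q * cnj (c r) * add_char p (k * (h q - h r)))"
    by (simp only: of_real_sum cmod_sum_power2 expand)
  also have "\<dots> = (\<Sum>q\<in>Q. \<Sum>r\<in>Q. \<Sum>k\<in>?K. c q * cnj (c r) * add_char p (k * (h q - h r)))"
    by (subst sum.swap) (intro sum.cong refl sum.swap)
  also have "\<dots> = (\<Sum>q\<in>Q. \<Sum>r\<in>Q. if ?E q r then of_nat p * (c q * cnj (c r)) else 0)"
    by (intro sum.cong refl) (simp add: sum_add_char[OF p] flip: sum_distrib_left)
  finally have 1: "complex_of_real (\<Sum>k\<in>?K. (cmod (\<Sum>q\<in>Q. c q * add_char p (k * h q)))\<^sup>2)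
      = (\<Sum>q\<in>Q. \<Sum>r\<in>Q. if ?E q r then of_nat p * (c q * cnj (c r)) else 0)" .
  have fib: "(\<Sum>q\<in>{q\<in>Q. h q mod int p = t}. c q) = (\<Sum>q\<in>Q. if h q mod int p = t then c q else 0)" for t
    using Q by (simp add: sum.If_cases Int_def)
  \<comment> \<open>That \<open>q\<close> and \<open>r\<close> both lie in the fibre over
    \<open>t\<close> is written as \<open>t = h q mod int p\<close> together with
    \<open>?E q r\<close>, so that the sum over \<open>t\<close> collapses to one residue.\<close>
  have "complex_of_real (\<Sum>t\<in>?K. (cmod (\<Sum>q\<in>{q\<in>Q. h q mod int p = t}. c q))\<^sup>2)
     = (\<Sum>t\<in>?K. \<Sum>q\<in>Q. \<Sum>r\<in>Q. if t = h q mod int p then if ?E q r then c q * cnj (c r) else 0 else 0)"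
    unfolding fib of_real_sum cmod_sum_power2
    by (intro sum.cong refl) (auto simp: mod_eq_dvd_iff dvd_diff_commute)
  also have "\<dots> = (\<Sum>q\<in>Q. \<Sum>r\<in>Q. \<Sum>t\<in>?K. if t = h q mod int p then if ?E q r then c q * cnj (c r) else 0 else 0)"
    by (subst sum.swap) (intro sum.cong refl sum.swap)
  also have "\<dots> = (\<Sum>q\<in>Q. \<Sum>r\<in>Q. if ?E q r then c q * cnj (c r) else 0)"
    using K by (subst sum.delta) (auto intro!: sum.cong)
  finally have 2: "complex_of_real (real p * (\<Sum>t\<in>?K. (cmod (\<Sum>q\<in>{q\<in>Q. h q mod int p = t}. c q))\<^sup>2))
     = (\<Sum>q\<in>Q. \<Sum>r\<in>Q. if ?E q r then of_nat p * (c q * cnj (c r)) else 0)"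
    unfolding of_real_mult by (simp only: of_real_of_nat_eq sum_distrib_left if_distrib mult_zero_right cong: if_cong)
  from 1 2 [symmetric] have "complex_of_real (\<Sum>k\<in>?K. (cmod (\<Sum>q\<in>Q. c q * add_char p (k * h q)))\<^sup>2)
     = complex_of_real (real p * (\<Sum>t\<in>?K. (cmod (\<Sum>q\<in>{q\<in>Q. h q mod int p = t}. c q))\<^sup>2))"
    by (rule trans)
  then show ?thesis by (simp only: of_real_eq_iff)
qed

section \<open>Splitting of both norms over the diagonals\<close>

text \<open>A fibre of the frequency map of \<open>parseval_fibres\<close>, taken modulo
  \<open>p\<close>: a diagonal with \<open>t > 0\<close> wraps around and also contains pairs with
  \<open>snd q - fst q = t - int p\<close>.\<close>

definition diag :: "nat \<Rightarrow> int \<Rightarrow> (int \<times> int) set" where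
  "diag p t = {q \<in> {1..int p - 1} \<times> {1..int p - 1}. (snd q - fst q) mod int p = t}"

text \<open>Conjugation in the second argument of the inner product merges the two characters into a
  single one of frequency \<open>snd q - fst q\<close>.\<close>

lemma meas_map_eq_sum:
  assumes p: "prime p" and k: "k \<in> {0..<int p}" and l: "l \<in> {1..int p - 1}"
  shows "meas_map p \<phi> A (k, l) =
    (\<Sum>q\<in>{1..int p - 1} \<times> {1..int p - 1}.
       A q * \<phi> (l * snd q mod int p) * cnj (\<phi> (l * fst q mod int p)) * add_char p (k * (snd q - fst q)))"
proof -
  have p0: "p > 0" using p by (rule prime_gt_0_nat)
  have rep: "affine_rep p (k, l) \<phi> m = add_char p (k * m) * \<phi> (l * m mod int p)"
    if "m \<in> {1..int p - 1}" for m
    using that p0 by (simp add: affine_rep_def Fpx_eq[OF p]) (simp add: residue_ring_def add_char_mod)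
  have "meas_map p \<phi> A (k, l) = (\<Sum>i\<in>{1..int p - 1}. (\<Sum>j\<in>{1..int p - 1}.
     A (i, j) * (add_char p (k * j) * \<phi> (l * j mod int p))) * cnj (add_char p (k * i) * \<phi> (l * i mod int p)))"
    unfolding meas_map_def carrier_affine_group[OF p] l2inner_def mat_vec_def Fpx_eq[OF p]
    using k l by (simp add: rep del: atLeastAtMost_iff complex_cnj_mult cong: sum.cong)
  also have "\<dots> = (\<Sum>i\<in>{1..int p - 1}. \<Sum>j\<in>{1..int p - 1}.
      A (i, j) * \<phi> (l * j mod int p) * cnj (\<phi> (l * i mod int p)) * add_char p (k * (j - i)))"
    unfolding sum_distrib_right
    by (intro sum.cong refl)
      (simp add: add_char_cnj right_diff_distrib flip: add_char_add[of p "k * j" "- (k * i)" for i j, simplified])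
  finally show ?thesis by (simp add: sum.cartesian_product case_prod_beta)
qed

lemma norm_G_meas_map_power2:
  assumes p: "prime p"
  shows "(norm_G p (meas_map p \<phi> A))\<^sup>2 = real p * (\<Sum>t\<in>{0..<int p}. \<Sum>l\<in>{1..int p - 1}.
    (cmod (\<Sum>q\<in>diag p t. A q * \<phi> (l * snd q mod int p) * cnj (\<phi> (l * fst q mod int p))))\<^sup>2)"
proof -
  have p0: "p > 0" using p by (rule prime_gt_0_nat)
  have "(norm_G p (meas_map p \<phi> A))\<^sup>2
     = (\<Sum>(k, l)\<in>{0..<int p} \<times> {1..int p - 1}. (cmod (meas_map p \<phi> A (k, l)))\<^sup>2)"
    by (simp add: l2norm_def L2_set_def sum_nonneg carrier_affine_group[OF p] case_prod_beta)
  also have "\<dots> = (\<Sum>l\<in>{1..int p - 1}. \<Sum>k\<in>{0..<int p}. (cmod (meas_map p \<phi> A (k, l)))\<^sup>2)"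
    by (simp only: sum.cartesian_product [symmetric]) (rule sum.swap)
  also have "\<dots> = (\<Sum>l\<in>{1..int p - 1}. real p * (\<Sum>t\<in>{0..<int p}.
    (cmod (\<Sum>q\<in>diag p t. A q * \<phi> (l * snd q mod int p) * cnj (\<phi> (l * fst q mod int p))))\<^sup>2))"
    unfolding diag_def
    by (intro sum.cong refl, subst parseval_fibres[OF p0, symmetric])
      (simp_all add: meas_map_eq_sum[OF p] del: atLeastAtMost_iff atLeastLessThan_iff cong: sum.cong)
  finally show ?thesis by (subst (asm) sum_distrib_left [symmetric], subst (asm) sum.swap)
qed

lemma frob_norm_power2:
  assumes p: "prime p"
  shows "(frob_norm p A)\<^sup>2 = (\<Sum>t\<in>{0..<int p}. \<Sum>q\<in>diag p t. (cmod (A q))\<^sup>2)"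
proof -
  have "(\<Sum>t\<in>{0..<int p}. \<Sum>q\<in>diag p t. (cmod (A q))\<^sup>2)
      = (\<Sum>q\<in>{1..int p - 1} \<times> {1..int p - 1}. (cmod (A q))\<^sup>2)"
    unfolding diag_def using prime_gt_0_nat[OF p] by (intro sum.group) auto
  then show ?thesis
    by (simp add: frob_norm_def l2norm_def L2_set_def sum_nonneg Fpx_eq[OF p])
qed

section \<open>Spectral bound for the path\<close>

text \<open>
  The weights \<open>s k = sin (pi k / n)\<close> come from the eigenvector of the least eigenvalue: weighted AM-GM on
  each edge yields a telescoping bound. At both ends of the path, \<open>x / 0 = 0\<close> makes it hold without
  special treatment of the weights.
\<close>

lemma path_incidence_lower_bound:
  fixes a :: "nat \<Rightarrow> complex"
  assumes n: "n \<ge> 1" and a0: "a 0 = 0" and an: "a n = 0"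
  shows "(2 * sin (pi / (2 * n)))\<^sup>2 * (\<Sum>k<n. (cmod (a k))\<^sup>2) \<le> (\<Sum>k<n. (cmod (a (Suc k) + a k))\<^sup>2)"
proof -
  define s where "s = (\<lambda>k::nat. sin (pi * k / n))"
  have s_pos: "s k > 0" if "0 < k" "k < n" for k
    unfolding s_def using that n by (intro sin_gt_zero) (auto simp: field_simps)
  have s0: "s 0 = 0" and sn: "s n = 0" using n by (simp_all add: s_def)
  define u where "u = (\<lambda>k. (cmod (a k))\<^sup>2)"
  have edge: "(1 - s k / s (Suc k)) * u (Suc k) + (1 - s (Suc k) / s k) * u k \<le> (cmod (a (Suc k) + a k))\<^sup>2"
    if "k < n" for k
  proof (cases "k = 0 \<or> Suc k = n")
    case True
    then show ?thesis using a0 an s0 sn by (auto simp: u_def)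
  next
    case False
    then have sk: "s k > 0" "s (Suc k) > 0" using that s_pos[of k] s_pos[of "Suc k"] by auto
    \<comment> \<open>With this scaling the mixed term of the square below is free of
      \<open>r\<close>, while the square terms carry exactly the two weights of the claim.\<close>
    define r where "r = sqrt (s k / s (Suc k))"
    have r: "r > 0" "r\<^sup>2 = s k / s (Suc k)" "1 / r\<^sup>2 = s (Suc k) / s k" using sk by (auto simp: r_def)
    let ?x = "cmod (a (Suc k))" and ?y = "cmod (a k)"
    have "0 \<le> (r * ?x - ?y / r)\<^sup>2" by simp
    also have "\<dots> = r\<^sup>2 * ?x\<^sup>2 + (1 / r\<^sup>2) * ?y\<^sup>2 - 2 * ?x * ?y"
      using r(1) by (simp add: power2_diff power_mult_distrib power_divide)
    finally have "2 * ?x * ?y \<le> s k / s (Suc k) * ?x\<^sup>2 + s (Suc k) / s k * ?y\<^sup>2"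
      unfolding r by simp
    \<comment> \<open>Reverse triangle inequality: \<open>a (Suc k) + a k\<close> is smallest when
      the two values have opposite phase.\<close>
    moreover have "(?x - ?y)\<^sup>2 \<le> (cmod (a (Suc k) + a k))\<^sup>2"
      using norm_triangle_ineq3[of "a (Suc k)" "- a k"] by (simp add: abs_le_square_iff [symmetric])
    ultimately show ?thesis
      unfolding u_def by (simp add: power2_diff algebra_simps)
  qed
  \<comment> \<open>The shift moves all weights to the index \<open>k\<close>; the boundary terms
    drop because \<open>a 0 = a n = 0\<close>. At \<open>k = 0\<close> truncated subtraction makes
    \<open>s (k - 1)\<close> equal to \<open>s 0\<close>, which is harmless since
    \<open>u 0 = 0\<close>.\<close>
  have "(\<Sum>k<n. (1 - s k / s (Suc k)) * u (Suc k)) = (\<Sum>k<n. (1 - s (k - 1) / s k) * u k)"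
  proof -
    have "(\<Sum>k<n. (1 - s k / s (Suc k)) * u (Suc k)) = (\<Sum>k<Suc n. (1 - s (k - 1) / s k) * u k)"
      by (subst sum.lessThan_Suc_shift) (simp add: u_def a0)
    then show ?thesis by (simp add: u_def an)
  qed
  then have "(\<Sum>k<n. (1 - s k / s (Suc k)) * u (Suc k) + (1 - s (Suc k) / s k) * u k)
      = (\<Sum>k<n. (2 - (s (k - 1) + s (Suc k)) / s k) * u k)"
    by (simp only: sum.distrib) (simp add: sum.distrib [symmetric] algebra_simps add_divide_distrib)
  also have "\<dots> = (\<Sum>k<n. (2 * sin (pi / (2 * n)))\<^sup>2 * u k)"
  proof (intro sum.cong refl)
    fix k assume "k \<in> {..<n}"
    show "(2 - (s (k - 1) + s (Suc k)) / s k) * u k = (2 * sin (pi / (2 * n)))\<^sup>2 * u k"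
    proof (cases "k = 0")
      case False
      then have "s k > 0" using s_pos \<open>k \<in> {..<n}\<close> by auto
      have "s (k - 1) = sin (pi * k / n - pi / n)" "s (Suc k) = sin (pi * k / n + pi / n)"
        using False n by (simp_all add: s_def field_simps of_nat_diff)
      \<comment> \<open>The sine profile is an eigenvector of the neighbour sum with eigenvalue
        \<open>2 * cos (pi / n)\<close>, and \<open>2 - 2 * cos (pi / n)\<close> is the required
        square by the half-angle formula.\<close>
      then have "s (k - 1) + s (Suc k) = 2 * cos (pi / n) * s k"
        by (simp add: s_def sin_add sin_diff)
      then have "(s (k - 1) + s (Suc k)) / s k = 2 * cos (pi / n)" using \<open>s k > 0\<close> by simp
      moreover have "cos (pi / n) = 1 - 2 * (sin (pi / (2 * n)))\<^sup>2"
        using cos_double_sin[of "pi / (2 * n)"] by simp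
      ultimately show ?thesis by (simp add: power2_eq_square)
    qed (simp add: u_def a0)
  qed
  finally show ?thesis
    using sum_mono[OF edge, of "{..<n}" "\<lambda>k. k"] by (simp add: u_def sum_distrib_left)
qed

text \<open>Isolates the cross term. In the applications \<open>z\<close> is a positive multiple of
  the sum of an edge or diagonal function, and the cross term is then a nonnegative multiple of the
  squared modulus of that sum.\<close>

lemma sum_cmod_add_const_power2:
  "(\<Sum>k\<in>K. (cmod (b k + z))\<^sup>2) = (\<Sum>k\<in>K. (cmod (b k))\<^sup>2) + card K * (cmod z)\<^sup>2 + 2 * Re (cnj z * (\<Sum>k\<in>K. b k))"
proof -
  have "(cmod (b k + z))\<^sup>2 = (cmod (b k))\<^sup>2 + (cmod z)\<^sup>2 + 2 * Re (cnj z * b k)" for k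
    unfolding cmod_power2 by (simp add: power2_eq_square algebra_simps)
  then show ?thesis by (simp add: sum.distrib sum_distrib_left)
qed

section \<open>Unit residues and the path parametrisation of a diagonal\<close>

lemma ex_inverse_mod:
  assumes "prime p" "t \<in> {1..int p - 1}"
  shows "\<exists>s\<in>{1..int p - 1}. s * t mod int p = 1"
proof -
  have p: "prime (int p)" using assms by simp
  have p1: "int p > 1" using p by (rule prime_gt_1_int)
  have "\<not> int p dvd t" using assms(2) zdvd_not_zless[of t "int p"] by auto
  then have "coprime t (int p)" using p by (metis coprime_commute prime_imp_coprime)
  then obtain x where "[t * x = 1] (mod int p)" using cong_solve_coprime_int by blast
  then have 1: "(x mod int p) * t mod int p = 1" using p1 by (simp add: cong_def mod_simps mult.commute)
  then have "x mod int p \<noteq> 0" by auto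
  then have "x mod int p \<in> {1..int p - 1}" using p1 pos_mod_bound[of "int p" x] pos_mod_sign[of "int p" x]
    unfolding atLeastAtMost_iff by linarith
  with 1 show ?thesis by blast
qed

text \<open>Uniqueness of the inverse of \<open>l * t\<close>: multiplying each congruence by the
  other unknown gives the same product. It locates the peak of the dilated vector.\<close>

lemma mult_mod_eq_1_iff:
  fixes p l t x y :: int
  assumes "l * (t * y) mod p = 1" "x \<in> {0..<p}" "y \<in> {0..<p}"
  shows "l * (t * x) mod p = 1 \<longleftrightarrow> x = y"
proof
  assume "l * (t * x) mod p = 1"
  then have "[l * (t * x) = 1] (mod p)" "[l * (t * y) = 1] (mod p)" using assms
    by (metis cong_def mod_mod_trivial)+
  then have "[(l * (t * x)) * y = 1 * y] (mod p)" "[(l * (t * y)) * x = 1 * x] (mod p)"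
    using cong_mult[OF _ cong_refl] by blast+
  moreover have "(l * (t * x)) * y = (l * (t * y)) * x" by simp
  ultimately have "[x = y] (mod p)" by (metis cong_sym cong_trans mult_1)
  then show "x = y" using assms by (simp add: cong_def)
qed (use assms in auto)

text \<open>Division by \<open>t\<close> turns a pair with difference \<open>t\<close> into
  consecutive residues \<open>x\<close> and \<open>x + 1\<close>. Both must be nonzero modulo
  \<open>p\<close>, which rules out \<open>x = 0\<close> and \<open>x = p - 1\<close> and leaves the
  \<open>p - 2\<close> edges of a path on \<open>1, ..., p - 1\<close>.\<close>

lemma bij_betw_path_diag:
  assumes p: "prime p" and t: "t \<in> {1..int p - 1}"
  shows "bij_betw (\<lambda>x. (t * x mod int p, t * (x + 1) mod int p)) {1..int p - 2} (diag p t)"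
proof -
  have pp: "prime (int p)" using p by simp
  have p1: "int p > 1" using pp by (rule prime_gt_1_int)
  obtain s where s: "s * t mod int p = 1" using ex_inverse_mod[OF p t] by blast
  have st: "s * (t * x) mod int p = x mod int p" for x
  proof -
    have "s * (t * x) mod int p = (s * t mod int p) * x mod int p" by (simp add: mod_simps mult.assoc)
    then show ?thesis by (simp add: s)
  qed
  have ts: "t * (s * x) mod int p = x mod int p" for x using st[of x] by (simp add: mult_ac)
  have unit: "t * x mod int p \<in> {1..int p - 1}" if "x \<in> {1..int p - 1}" for x
  proof -
    have "t * x mod int p \<noteq> 0"
      using st[of x] that by (metis atLeastAtMost_iff mod_mult_right_eq mod_pos_pos_trivial mult_zero_right
         not_one_le_zero order_le_less_trans zle_diff1_eq mod_0 order.trans zero_le_one)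
    then show ?thesis using p1 pos_mod_bound[of "int p" "t * x"] pos_mod_sign[of "int p" "t * x"]
      unfolding atLeastAtMost_iff by linarith
  qed
  show ?thesis
  proof (rule bij_betw_byWitness[where f' = "\<lambda>q. s * fst q mod int p"])
    show "\<forall>x\<in>{1..int p - 2}. s * fst (t * x mod int p, t * (x + 1) mod int p) mod int p = x"
      by (simp add: mod_mult_right_eq st)
    show "(\<lambda>x. (t * x mod int p, t * (x + 1) mod int p)) ` {1..int p - 2} \<subseteq> diag p t"
    proof
      fix q assume "q \<in> (\<lambda>x. (t * x mod int p, t * (x + 1) mod int p)) ` {1..int p - 2}"
      then obtain x where x: "x \<in> {1..int p - 2}" "q = (t * x mod int p, t * (x + 1) mod int p)" by blast
      have "(t * (x + 1) mod int p - t * x mod int p) mod int p = (t * (x + 1) - t * x) mod int p"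
        by (simp add: mod_simps)
      also have "\<dots> = t" using t by (simp add: algebra_simps)
      finally show "q \<in> diag p t" using x unit[of x] unit[of "x + 1"] by (simp add: diag_def del: atLeastAtMost_iff) auto
    qed
    \<comment> \<open>One claim serves for both the right inverse and the range of the witness,
      which divides the first index by \<open>t\<close>.\<close>
    have preimage: "q = (t * x mod int p, t * (x + 1) mod int p) \<and> x \<in> {1..int p - 2}"
      if q: "q \<in> diag p t" and x: "x = s * fst q mod int p" for q x
    proof -
      have q': "fst q \<in> {1..int p - 1}" "snd q \<in> {1..int p - 1}" "(snd q - fst q) mod int p = t"
        using q by (auto simp: diag_def)
      have 1: "t * x mod int p = fst q" using q' by (simp add: x mod_mult_right_eq ts)
      have "t * (x + 1) mod int p = (t * x mod int p + (snd q - fst q) mod int p) mod int p"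
        using q'(3) by (simp add: mod_simps algebra_simps)
      also have "\<dots> = snd q" using q'(2) by (simp add: 1 mod_simps)
      finally have 2: "t * (x + 1) mod int p = snd q" .
      have "x \<noteq> 0" using 1 q'(1) by auto
      moreover have "x + 1 \<noteq> int p" using 2 q'(2) by auto
      moreover have "0 \<le> x" "x < int p" using p1 by (simp_all add: x)
      ultimately have "x \<in> {1..int p - 2}" by auto
      with 1 2 show ?thesis by (simp add: prod_eq_iff)
    qed
    show "\<forall>q\<in>diag p t. (t * (s * fst q mod int p) mod int p, t * (s * fst q mod int p + 1) mod int p) = q"
      using preimage by metis
    show "(\<lambda>q. s * fst q mod int p) ` diag p t \<subseteq> {1..int p - 2}" using preimage by blast
  qed
qed

text \<open>The change of variable \<open>l = 1 / (t * y)\<close> in the sum over dilations: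
  \<open>y\<close> becomes the path vertex at which the dilated vector has its peak.\<close>

lemma ex_bij_inverse_mult:
  assumes p: "prime p" and t: "t \<in> {1..int p - 1}"
  obtains r where "bij_betw r {1..int p - 1} {1..int p - 1}"
    "\<And>y. y \<in> {1..int p - 1} \<Longrightarrow> r y * (t * y) mod int p = 1"
proof -
  let ?X = "{1..int p - 1}"
  have "\<forall>y\<in>?X. \<exists>l\<in>?X. l * (t * y) mod int p = 1"
  proof
    fix y assume y: "y \<in> ?X"
    have pp: "prime (int p)" using p by simp
    have "\<not> int p dvd t * y"
      using t y by (auto simp: prime_dvd_mult_iff[OF pp] dest!: zdvd_imp_le)
    then have "t * y mod int p \<in> ?X"
      using pos_mod_bound[of "int p" "t * y"] pos_mod_sign[of "int p" "t * y"] prime_gt_1_int[OF pp]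
      unfolding dvd_eq_mod_eq_0 atLeastAtMost_iff by linarith
    from ex_inverse_mod[OF p this] show "\<exists>l\<in>?X. l * (t * y) mod int p = 1"
      by (simp add: mod_mult_right_eq)
  qed
  then obtain r where r: "\<And>y. y \<in> ?X \<Longrightarrow> r y \<in> ?X" "\<And>y. y \<in> ?X \<Longrightarrow> r y * (t * y) mod int p = 1"
    by metis
  have "inj_on r ?X"
  proof (rule inj_onI)
    fix x y assume xy: "x \<in> ?X" "y \<in> ?X" "r x = r y"
    then have "r y * (t * x) mod int p = 1" using r(2)[OF xy(1)] by simp
    with mult_mod_eq_1_iff[OF r(2)[OF xy(2)], of x] xy show "x = y" by auto
  qed
  then have "bij_betw r ?X ?X"
    using r(1) endo_inj_surj[of ?X r] by (simp add: bij_betw_def image_subset_iff del: atLeastAtMost_iff)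
  with r(2) that show ?thesis by blast
qed

lemma sum_diag_path:
  assumes p: "prime p" and t: "t \<in> {1..int p - 1}"
  shows "(\<Sum>q\<in>diag p t. f q) = (\<Sum>k\<in>{1..<p - 1}. f (t * int k mod int p, t * (int k + 1) mod int p))"
proof -
  have p1: "p > 1" using p by (rule prime_gt_1_nat)
  have "int ` {1..<p - 1} = {1..int p - 2}"
    using p1 by (subst image_int_atLeastLessThan) auto
  then have "bij_betw int {1..<p - 1} {1..int p - 2}" by (simp add: bij_betw_def)
  from bij_betw_trans[OF this bij_betw_path_diag[OF p t]] show ?thesis
    by (subst sum.reindex_bij_betw[symmetric]) (simp_all add: o_def)
qed

lemma sum_diag_0: "(\<Sum>q\<in>diag p 0. f q) = (\<Sum>i\<in>{1..int p - 1}. f (i, i))"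
proof (intro sum.reindex_bij_betw[symmetric, where h = "\<lambda>i. (i, i)" and g = f, simplified])
  have "i = j" if "i \<in> {1..int p - 1}" "j \<in> {1..int p - 1}" "(j - i) mod int p = 0" for i j
    using that by (simp add: mod_eq_dvd_iff[symmetric] dvd_eq_mod_eq_0[symmetric])
  then show "bij_betw (\<lambda>i. (i, i)) {1..int p - 1} (diag p 0)"
    unfolding bij_betw_def diag_def by (force simp: inj_on_def simp del: atLeastAtMost_iff)
qed

section \<open>Energy of a single diagonal\<close>

text \<open>Dilation by \<open>r = 1 / (t * y)\<close> sends \<open>t * x\<close> to
  \<open>x / y\<close>, a unit that hits the peak at 1 only for \<open>x = y\<close>.\<close>

lemma phi_star_scaled:
  assumes p: "prime p" and r: "r * (t * y) mod int p = 1"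
    and x: "x \<in> {1..int p - 1}" and y: "y \<in> {1..int p - 1}"
  shows "phi_star p (r * (t * x mod int p) mod int p)
    = (1 + (if x = y then sqrt (real (p - 1)) else 0)) / sqrt (2 * real (p - 1) + 2 * sqrt (real (p - 1)))"
proof -
  have pp: "prime (int p)" using p by simp
  have "\<not> int p dvd r * (t * y)" using r by (simp add: dvd_eq_mod_eq_0)
  then have "\<not> int p dvd r" "\<not> int p dvd t" by (auto intro: dvd_mult2 dvd_mult)
  moreover have "\<not> int p dvd x" using x by (auto dest!: zdvd_imp_le)
  ultimately have "\<not> int p dvd r * (t * x)" by (simp add: prime_dvd_mult_iff[OF pp])
  then have "r * (t * x) mod int p \<in> Fpx p"
    using pos_mod_bound[of "int p" "r * (t * x)"] pos_mod_sign[of "int p" "r * (t * x)"] prime_gt_1_int[OF pp]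
    unfolding Fpx_eq[OF p] dvd_eq_mod_eq_0 atLeastAtMost_iff by linarith
  moreover have "r * (t * x) mod int p = 1 \<longleftrightarrow> x = y"
    using x y by (intro mult_mod_eq_1_iff[OF r]) auto
  moreover have "\<one>\<^bsub>Fp p\<^esub> = 1" by (simp add: residue_ring_def)
  ultimately show ?thesis by (simp add: phi_star_def Let_def mod_mult_right_eq)
qed

text \<open>The matrix entry on the edge joining the vertices \<open>k\<close> and
  \<open>k + 1\<close>. The zeros at \<open>0\<close> and \<open>p - 1\<close> act as phantom edges,
  so that the two end vertices also meet two edges each.\<close>

definition path_coeff :: "nat \<Rightarrow> (int \<times> int \<Rightarrow> complex) \<Rightarrow> int \<Rightarrow> nat \<Rightarrow> complex" where
  "path_coeff p A t k =
     (if k \<in> {1..<p - 1} then A (t * int k mod int p, t * (int k + 1) mod int p) else 0)"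

lemma path_coeff_ends [simp]: "path_coeff p A t 0 = 0" "path_coeff p A t (p - Suc 0) = 0"
  by (simp_all add: path_coeff_def)

lemma sum_diag_path_coeff:
  assumes p: "prime p" and t: "t \<in> {1..int p - 1}"
  shows "(\<Sum>q\<in>diag p t. (cmod (A q))\<^sup>2) = (\<Sum>k<p - 1. (cmod (path_coeff p A t k))\<^sup>2)"
  unfolding sum_diag_path[OF p t]
  by (intro sum.mono_neutral_cong_left) (auto simp: path_coeff_def)

text \<open>The share of one diagonal in \<open>norm_G_meas_map_power2\<close>, without the factor
  \<open>p\<close>.\<close>

abbreviation diag_energy :: "nat \<Rightarrow> (int \<times> int \<Rightarrow> complex) \<Rightarrow> int \<Rightarrow> real" where
  "diag_energy p A t \<equiv> (\<Sum>l\<in>{1..int p - 1}. (cmod (\<Sum>q\<in>diag p t.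
     A q * phi_star_c p (l * snd q mod int p) * cnj (phi_star_c p (l * fst q mod int p))))\<^sup>2)"

text \<open>Each edge has two endpoints, so summing over the vertices counts it twice.\<close>

lemma sum_path_eq:
  fixes a :: "nat \<Rightarrow> complex"
  assumes "a 0 = 0" "a n = 0"
  shows "(\<Sum>k<n. a (Suc k) + a k) = 2 * (\<Sum>k<n. a k)"
proof -
  have "(\<Sum>k<n. a (Suc k)) = (\<Sum>k<Suc n. a k)"
    by (subst sum.lessThan_Suc_shift) (simp add: assms)
  then show ?thesis by (simp add: sum.distrib assms)
qed

text \<open>For a peak at vertex \<open>j + 1\<close>, the constant part of the vector contributes
  the total \<open>S\<close> and the peak contributes \<open>sqrt n\<close> times the two edges at
  that vertex. The total thus acts as a constant shift \<open>z\<close> of the incidence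
  sums.\<close>

lemma diag_energy_offdiagonal:
  fixes p n :: nat
  defines "n \<equiv> p - 1"
  assumes p: "prime p" and t: "t \<in> {1..int p - 1}"
  shows "diag_energy p A t = (1 / (2 * (sqrt n + 1)))\<^sup>2 *
    ((\<Sum>k<n. (cmod (path_coeff p A t (Suc k) + path_coeff p A t k))\<^sup>2)
      + (1 + 4 / sqrt n) * (cmod (\<Sum>k<n. path_coeff p A t k))\<^sup>2)"
proof -
  have n: "n \<ge> 1" using prime_gt_1_nat[OF p] by (simp add: n_def)
  define c where "c = 2 * real n + 2 * sqrt n"
  have c: "c > 0" using n by (auto simp: c_def intro!: add_pos_nonneg)
  define a where "a = path_coeff p A t"
  define S where "S = (\<Sum>k<n. a k)"
  define z where "z = S / of_real (sqrt n)"
  have ends: "a 0 = 0" "a n = 0" by (simp_all only: a_def n_def path_coeff_ends One_nat_def)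
  obtain r where r: "bij_betw r {1..int p - 1} {1..int p - 1}"
    "\<And>y. y \<in> {1..int p - 1} \<Longrightarrow> r y * (t * y) mod int p = 1"
    using ex_bij_inverse_mult[OF p t] by blast
  \<comment> \<open>Vertices are numbered from 1 and the summation index \<open>j\<close> from
    0.\<close>
  have "(\<lambda>j. int j + 1) ` {..<n} = (\<lambda>x. x + 1) ` int ` {0..<n}"
    by (simp add: image_image atLeast0LessThan)
  also have "\<dots> = {1..int p - 1}"
    using n by (simp only: image_int_atLeastLessThan image_add_atLeastLessThan') (auto simp: n_def)
  finally have "(\<lambda>j. int j + 1) ` {..<n} = {1..int p - 1}" .
  then have "bij_betw (\<lambda>j. int j + 1) {..<n} {1..int p - 1}" by (auto simp: bij_betw_def inj_on_def)
  note bij = bij_betw_trans[OF this r(1), unfolded o_def]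
  have inner: "(\<Sum>q\<in>diag p t. A q * phi_star_c p (r (int j + 1) * snd q mod int p)
        * cnj (phi_star_c p (r (int j + 1) * fst q mod int p)))
      = of_real (sqrt n / c) * (a (Suc j) + a j + z)" if j: "j < n" for j
  proof -
    have y: "int j + 1 \<in> {1..int p - 1}" using j n by (auto simp: n_def)
    have "(\<Sum>q\<in>diag p t. A q * phi_star_c p (r (int j + 1) * snd q mod int p)
        * cnj (phi_star_c p (r (int j + 1) * fst q mod int p)))
      = (\<Sum>k\<in>{1..<n}. a k * of_real ((1 + (if k = Suc j then sqrt n else 0) + (if k = j then sqrt n else 0)) / c))"
      unfolding sum_diag_path[OF p t] n_def[symmetric]
    proof (intro sum.cong refl)
      fix k assume k: "k \<in> {1..<n}"
      have k': "int k \<in> {1..int p - 1}" "int k + 1 \<in> {1..int p - 1}" using k by (auto simp: n_def)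
      \<comment> \<open>The two ends of an edge are distinct, so at most one of them is the peak and
        the product of the two values has no term with both excesses.\<close>
      have eqs: "int k = int j + 1 \<longleftrightarrow> k = Suc j" "int k + 1 = int j + 1 \<longleftrightarrow> k = j" by auto
      have "phi_star p (r (int j + 1) * (t * (int k + 1) mod int p) mod int p)
          * phi_star p (r (int j + 1) * (t * int k mod int p) mod int p)
        = (1 + (if k = Suc j then sqrt n else 0) + (if k = j then sqrt n else 0)) / c"
        unfolding phi_star_scaled[OF p r(2)[OF y] k'(1) y] phi_star_scaled[OF p r(2)[OF y] k'(2) y] eqs
          n_def[symmetric] c_def[symmetric]
        using c by (auto simp: field_simps)
      then show "A (t * int k mod int p, t * (int k + 1) mod int p)
          * phi_star_c p (r (int j + 1) * snd (t * int k mod int p, t * (int k + 1) mod int p) mod int p)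
          * cnj (phi_star_c p (r (int j + 1) * fst (t * int k mod int p, t * (int k + 1) mod int p) mod int p))
        = a k * of_real ((1 + (if k = Suc j then sqrt n else 0) + (if k = j then sqrt n else 0)) / c)"
        using k by (simp add: a_def path_coeff_def n_def mult.assoc flip: of_real_mult)
    qed
    \<comment> \<open>The range grows by the phantom edges \<open>0\<close> and \<open>n\<close>, so
      that both \<open>j\<close> and \<open>Suc j\<close> lie in it for every vertex.\<close>
    also have "\<dots> = (\<Sum>k<Suc n. a k * of_real ((1 + (if k = Suc j then sqrt n else 0) + (if k = j then sqrt n else 0)) / c))"
      using ends by (intro sum.mono_neutral_left) (auto simp: a_def path_coeff_def n_def)
    also have "\<dots> = (\<Sum>k<Suc n. a k / of_real c + (if k = Suc j then a k * of_real (sqrt n / c) else 0)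
         + (if k = j then a k * of_real (sqrt n / c) else 0))"
      by (intro sum.cong refl) (auto simp: field_simps add_divide_distrib)
    also have "\<dots> = S / of_real c + a (Suc j) * of_real (sqrt n / c) + a j * of_real (sqrt n / c)"
      using j ends by (simp add: sum.distrib S_def sum_divide_distrib del: sum.lessThan_Suc)
        (simp add: sum_divide_distrib)
    also have "\<dots> = of_real (sqrt n / c) * (a (Suc j) + a j + z)"
      using n c by (simp add: z_def field_simps)
    finally show ?thesis .
  qed
  have "diag_energy p A t = (\<Sum>j<n. (cmod (of_real (sqrt n / c) * (a (Suc j) + a j + z)))\<^sup>2)"
    by (subst sum.reindex_bij_betw[OF bij, symmetric]) (intro sum.cong refl, simp only: inner lessThan_iff)
  also have "\<dots> = (sqrt n / c)\<^sup>2 * (\<Sum>j<n. (cmod (a (Suc j) + a j + z))\<^sup>2)"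
    by (simp add: norm_mult power_mult_distrib sum_distrib_left norm_divide power_divide)
  also have "(\<Sum>j<n. (cmod (a (Suc j) + a j + z))\<^sup>2)
     = (\<Sum>j<n. (cmod (a (Suc j) + a j))\<^sup>2) + n * (cmod z)\<^sup>2 + 2 * Re (cnj z * (2 * S))"
    unfolding S_def sum_path_eq[OF ends, symmetric] sum_cmod_add_const_power2 by simp
  also have "n * (cmod z)\<^sup>2 = (cmod S)\<^sup>2"
    using n by (simp add: z_def norm_divide power_divide)
  also have "2 * Re (cnj z * (2 * S)) = 4 / sqrt n * (cmod S)\<^sup>2"
  proof -
    have "cnj z * (2 * S) = of_real (2 / sqrt n) * (S * cnj S)" by (simp add: z_def)
    also have "\<dots> = of_real (2 / sqrt n * (cmod S)\<^sup>2)"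
      by (simp only: complex_norm_square[symmetric] of_real_mult)
    finally show ?thesis by simp
  qed
  also have "sqrt n / c = 1 / (2 * (sqrt n + 1))"
  proof -
    have "c = sqrt n * (2 * (sqrt n + 1))" by (simp add: c_def algebra_simps)
    then show ?thesis using n by simp
  qed
  finally show ?thesis by (simp add: a_def S_def algebra_simps)
qed

text \<open>Here both indices meet the peak together, so the squared vector enters: a constant plus
  an excess at one point. The constant part only adds nonnegative terms, and the excess gives the
  factor.\<close>

lemma diag_energy_0_ge:
  fixes p n :: nat
  defines "n \<equiv> p - 1"
  assumes p: "prime p"
  shows "diag_energy p A 0 \<ge> ((sqrt n + 2) / (2 * (sqrt n + 1)))\<^sup>2 * (\<Sum>q\<in>diag p 0. (cmod (A q))\<^sup>2)"
proof -
  let ?X = "{1..int p - 1}"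
  have n: "n \<ge> 1" using prime_gt_1_nat[OF p] by (simp add: n_def)
  define c where "c = 2 * real n + 2 * sqrt n"
  have c: "c > 0" using n by (auto simp: c_def intro!: add_pos_nonneg)
  \<comment> \<open>The excess of the squared peak over the squared constant,
    \<open>(1 + sqrt n)\<^sup>2 - 1\<close>, before normalisation by \<open>c\<close>.\<close>
  define w where "w = n + 2 * sqrt n"
  define a where "a = (\<lambda>i. A (i, i))"
  define S where "S = (\<Sum>i\<in>?X. a i)"
  have w: "w > 0" using n by (auto simp: w_def intro!: add_pos_nonneg)
  have one: "1 \<in> ?X" using prime_gt_1_nat[OF p] by auto
  \<comment> \<open>The scaling is taken with 1, as the diagonal index 0 is not invertible.\<close>
  obtain r where r: "bij_betw r ?X ?X" "\<And>y. y \<in> ?X \<Longrightarrow> r y * (1 * y) mod int p = 1"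
    using ex_bij_inverse_mult[OF p one] by blast
  have inner: "(\<Sum>q\<in>diag p 0. A q * phi_star_c p (r y * snd q mod int p) * cnj (phi_star_c p (r y * fst q mod int p)))
      = of_real (w / c) * (a y + S / of_real w)" if y: "y \<in> ?X" for y
  proof -
    have "(\<Sum>q\<in>diag p 0. A q * phi_star_c p (r y * snd q mod int p) * cnj (phi_star_c p (r y * fst q mod int p)))
      = (\<Sum>i\<in>?X. a i / of_real c + (if i = y then a i * of_real (w / c) else 0))"
      unfolding sum_diag_0
    proof (intro sum.cong refl)
      fix i assume i: "i \<in> ?X"
      have "1 * i mod int p = i" using i by auto
      then have "phi_star p (r y * i mod int p) = (1 + (if i = y then sqrt n else 0)) / sqrt c"
        using phi_star_scaled[OF p r(2)[OF y] i y] unfolding n_def[symmetric] c_def[symmetric] by (simp only:)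
      then have "(phi_star p (r y * i mod int p))\<^sup>2 = 1 / c + (if i = y then w / c else 0)"
        using c by (simp add: power_divide w_def power2_sum add_divide_distrib mult.commute)
      then have "phi_star_c p (r y * i mod int p) * cnj (phi_star_c p (r y * i mod int p))
          = of_real (1 / c + (if i = y then w / c else 0))"
        by (simp add: power2_eq_square flip: of_real_mult)
      then show "A (i, i) * phi_star_c p (r y * snd (i, i) mod int p) * cnj (phi_star_c p (r y * fst (i, i) mod int p))
          = a i / of_real c + (if i = y then a i * of_real (w / c) else 0)"
        by (simp add: a_def mult.assoc del: complex_cnj_complex_of_real) (simp add: algebra_simps)
    qed
    also have "\<dots> = S / of_real c + a y * of_real (w / c)"
      using y by (simp add: sum.distrib S_def sum_divide_distrib)
    also have "\<dots> = of_real (w / c) * (a y + S / of_real w)"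
      using w c by (simp add: field_simps)
    finally show ?thesis .
  qed
  have "diag_energy p A 0 = (\<Sum>y\<in>?X. (cmod (of_real (w / c) * (a y + S / of_real w)))\<^sup>2)"
    by (subst sum.reindex_bij_betw[OF r(1), symmetric]) (intro sum.cong refl, simp only: inner)
  also have "\<dots> = (w / c)\<^sup>2 * (\<Sum>y\<in>?X. (cmod (a y + S / of_real w))\<^sup>2)"
    by (simp add: norm_mult power_mult_distrib sum_distrib_left norm_divide power_divide)
  finally have energy: "diag_energy p A 0 = (w / c)\<^sup>2 * (\<Sum>y\<in>?X. (cmod (a y + S / of_real w))\<^sup>2)" .
  have "(\<Sum>y\<in>?X. (cmod (a y + S / of_real w))\<^sup>2) \<ge> (\<Sum>y\<in>?X. (cmod (a y))\<^sup>2)"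
  proof -
    have "cnj (S / of_real w) * (\<Sum>y\<in>?X. a y) = (S * cnj S) / of_real w" by (simp add: S_def)
    also have "\<dots> = of_real ((cmod S)\<^sup>2 / w)" by (simp only: complex_norm_square[symmetric] of_real_divide)
    finally have "Re (cnj (S / of_real w) * (\<Sum>y\<in>?X. a y)) \<ge> 0" using w by simp
    moreover have "0 \<le> real (card ?X) * (cmod (S / of_real w))\<^sup>2" by simp
    ultimately show ?thesis unfolding sum_cmod_add_const_power2 by linarith
  qed
  then have "diag_energy p A 0 \<ge> (w / c)\<^sup>2 * (\<Sum>q\<in>diag p 0. (cmod (A q))\<^sup>2)"
    unfolding energy unfolding sum_diag_0 a_def by (intro mult_left_mono) auto
  moreover have "w / c = (sqrt n + 2) / (2 * (sqrt n + 1))"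
  proof -
    have "c = sqrt n * (2 * (sqrt n + 1))" "w = sqrt n * (sqrt n + 2)" by (simp_all add: c_def w_def algebra_simps)
    then show ?thesis using n by simp
  qed
  ultimately show ?thesis by simp
qed

section \<open>The lower bound and the norm of the inverse\<close>

lemma meas_map_diff:
  "meas_map p \<phi> (\<lambda>q. A q - B q) = (\<lambda>g. meas_map p \<phi> A g - meas_map p \<phi> B g)"
  by (rule ext) (auto simp: meas_map_def l2inner_def mat_vec_def left_diff_distrib sum_subtractf intro!: sum.cong)

lemma meas_map_scale:
  "meas_map p \<phi> (\<lambda>q. c * A q) = (\<lambda>g. c * meas_map p \<phi> A g)"
  by (rule ext) (auto simp: meas_map_def l2inner_def mat_vec_def sum_distrib_left mult_ac intro!: sum.cong)

lemma l2norm_scale: "l2norm X (\<lambda>x. c * f x) = cmod c * l2norm X f"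
  by (simp add: l2norm_def L2_set_def norm_mult power_mult_distrib real_sqrt_mult flip: sum_distrib_left)

lemma finite_Fpx: "prime p \<Longrightarrow> finite (Fpx p)"
  by (simp add: Fpx_eq)

lemma l2norm_nonneg [simp]: "l2norm X f \<ge> 0"
  by (simp add: l2norm_def)

lemma l2norm_eq_0_iff:
  assumes "finite X" "f \<in> fun_space X"
  shows "l2norm X f = 0 \<longleftrightarrow> f = (\<lambda>_. 0)"
  using assms by (auto simp: l2norm_def L2_set_eq_0_iff fun_space_def)

lemma frob_norm_eq_0_iff:
  assumes "prime p" "A \<in> mat_space p"
  shows "frob_norm p A = 0 \<longleftrightarrow> A = (\<lambda>_. 0)"
  using assms unfolding frob_norm_def by (intro l2norm_eq_0_iff) (simp_all add: finite_Fpx)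

text \<open>One constant works for every diagonal: off the main diagonal the term with the total sum
  is dropped and the path bound applies, and the main diagonal has a larger constant. Summing over
  \<open>t\<close> and multiplying by \<open>p\<close> gives both norms.\<close>

lemma meas_map_lower_bound:
  fixes p :: nat and n :: real
  defines "n \<equiv> real (p - 1)"
  assumes p: "prime p"
  shows "norm_G p (meas_map p (phi_star_c p) A)
    \<ge> sqrt (real p) / (sqrt n + 1) * sin (pi / (2 * n)) * frob_norm p A"
proof -
  have n: "n \<ge> 1" using prime_gt_1_nat[OF p] by (simp add: n_def)
  define \<sigma> where "\<sigma> = sin (pi / (2 * n)) / (sqrt n + 1)"
  have energy: "\<sigma>\<^sup>2 * (\<Sum>q\<in>diag p t. (cmod (A q))\<^sup>2) \<le> diag_energy p A t" if "t \<in> {0..<int p}" for t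
  proof (cases "t = 0")
    case True
    have "0 \<le> sin (pi / (2 * n))" using n by (intro sin_ge_zero) (auto simp: field_simps)
    then have "\<sigma> \<ge> 0" using n by (simp add: \<sigma>_def)
    moreover have "\<sigma> \<le> (sqrt n + 2) / (2 * (sqrt n + 1))"
    proof -
      have "sin (pi / (2 * n)) \<le> (sqrt n + 2) / 2"
        using n sin_le_one[of "pi / (2 * n)"] real_sqrt_ge_zero[of n] by (simp add: add_increasing)
      then have "\<sigma> \<le> ((sqrt n + 2) / 2) / (sqrt n + 1)"
        unfolding \<sigma>_def using n by (intro divide_right_mono) auto
      then show ?thesis by simp
    qed
    ultimately have "\<sigma>\<^sup>2 \<le> ((sqrt n + 2) / (2 * (sqrt n + 1)))\<^sup>2" by (intro power_mono)
    then show ?thesis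
      using diag_energy_0_ge[OF p, of A] True unfolding n_def
      by (meson order_trans mult_right_mono sum_nonneg zero_le_power2)
  next
    case False
    then have t: "t \<in> {1..int p - 1}" using that by auto
    let ?a = "path_coeff p A t"
    have "\<sigma>\<^sup>2 * (\<Sum>q\<in>diag p t. (cmod (A q))\<^sup>2)
        = (1 / (2 * (sqrt n + 1)))\<^sup>2 * ((2 * sin (pi / (2 * n)))\<^sup>2 * (\<Sum>k<p - 1. (cmod (?a k))\<^sup>2))"
    proof -
      have "x / y = 1 / (2 * y) * (2 * x)" for x y :: real by simp
      then have "\<sigma> = 1 / (2 * (sqrt n + 1)) * (2 * sin (pi / (2 * n)))" unfolding \<sigma>_def .
      then show ?thesis unfolding sum_diag_path_coeff[OF p t] by (simp only: power_mult_distrib mult.assoc)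
    qed
    also have "\<dots> \<le> (1 / (2 * (sqrt n + 1)))\<^sup>2 * ((\<Sum>k<p - 1. (cmod (?a (Suc k) + ?a k))\<^sup>2)
          + (1 + 4 / sqrt n) * (cmod (\<Sum>k<p - 1. ?a k))\<^sup>2)"
      using path_incidence_lower_bound[of "p - 1" ?a] prime_gt_1_nat[OF p] n
      by (intro mult_left_mono add_increasing2) (simp_all add: n_def)
    also have "\<dots> = diag_energy p A t"
      unfolding diag_energy_offdiagonal[OF p t] n_def ..
    finally show ?thesis .
  qed
  have "(sqrt p * \<sigma> * frob_norm p A)\<^sup>2 = p * (\<Sum>t\<in>{0..<int p}. \<sigma>\<^sup>2 * (\<Sum>q\<in>diag p t. (cmod (A q))\<^sup>2))"
    unfolding power_mult_distrib frob_norm_power2[OF p] by (simp add: sum_distrib_left mult.assoc)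
  also have "\<dots> \<le> p * (\<Sum>t\<in>{0..<int p}. diag_energy p A t)"
    by (intro mult_left_mono sum_mono energy) auto
  also have "\<dots> = (norm_G p (meas_map p (phi_star_c p) A))\<^sup>2"
    by (simp only: norm_G_meas_map_power2[OF p])
  finally show ?thesis
    unfolding \<sigma>_def by (auto dest: power2_le_imp_le)
qed

text \<open>Product of \<open>sqrt p / (sqrt n + 1) \<ge> 2 / 3\<close>, from
  \<open>sqrt n \<ge> 2\<close>, and \<open>sin (pi / (2 * n)) \<ge> 3 / (4 * n)\<close>, from the
  mean value theorem with cosine at least \<open>1 / 2\<close> up to \<open>pi / 3\<close> and from
  \<open>pi > 3\<close>.\<close>

lemma lower_bound_constant_ge:
  fixes p :: nat and n :: real
  defines "n \<equiv> real (p - 1)"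
  assumes p: "5 \<le> p"
  shows "1 / (2 * n) \<le> sqrt (real p) / (sqrt n + 1) * sin (pi / (2 * n))"
proof -
  have n: "n \<ge> 4" "n \<le> real p" using p by (simp_all add: n_def)
  define x where "x = pi / (2 * n)"
  have x: "0 < x" "x \<le> pi / 3" using n by (simp_all add: x_def field_simps)
  obtain \<xi> where \<xi>: "0 < \<xi>" "\<xi> < x" "sin x - sin 0 = (x - 0) * cos \<xi>"
    using MVT2[of 0 x sin cos] x(1) by (auto intro: derivative_eq_intros)
  have "cos \<xi> \<ge> cos (pi / 3)" using \<xi> x by (intro cos_monotone_0_pi_le) auto
  then have "x * (1 / 2) \<le> x * cos \<xi>" using x by (intro mult_left_mono) (auto simp: cos_60)
  then have "pi / (4 * n) \<le> sin x" using \<xi>(3) by (simp add: x_def)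
  moreover have "3 / (4 * n) \<le> pi / (4 * n)" using n pi_gt3 by (intro divide_right_mono) auto
  ultimately have sin: "3 / (4 * n) \<le> sin x" by simp
  have "2 \<le> sqrt n" using n by (intro real_le_rsqrt) auto
  moreover have "sqrt n \<le> sqrt p" using n by simp
  moreover have "2 / 3 \<le> y / (x + 1)" if "2 \<le> x" "x \<le> y" for x y :: real
    using that by (simp add: field_simps)
  ultimately have "2 / 3 \<le> sqrt p / (sqrt n + 1)" by blast
  then have "2 / 3 * (3 / (4 * n)) \<le> sqrt p / (sqrt n + 1) * sin x"
    using sin n by (intro mult_mono) auto
  then show ?thesis by (simp add: x_def)
qed

lemma inj_on_meas_map_phi_star:
  assumes p: "prime p" "5 \<le> p"
  shows "inj_on (meas_map p (phi_star_c p)) (mat_space p)"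
proof (rule inj_onI)
  fix A B assume AB: "A \<in> mat_space p" "B \<in> mat_space p"
    "meas_map p (phi_star_c p) A = meas_map p (phi_star_c p) B"
  let ?D = "\<lambda>q. A q - B q" and ?n = "real (p - 1)"
  have D: "?D \<in> mat_space p" using AB by (simp add: fun_space_def)
  have "meas_map p (phi_star_c p) ?D = (\<lambda>_. 0)"
    using AB(3) by (simp only: meas_map_diff diff_self)
  then have "sqrt (real p) / (sqrt ?n + 1) * sin (pi / (2 * ?n)) * frob_norm p ?D \<le> 0"
    using meas_map_lower_bound[OF p(1), of ?D] by (simp add: l2norm_def L2_set_def)
  moreover have "0 < sqrt (real p) / (sqrt ?n + 1) * sin (pi / (2 * ?n))"
    using p(2) by (intro less_le_trans[OF _ lower_bound_constant_ge]) auto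
  ultimately have "frob_norm p ?D \<le> 0" by (meson mult_pos_pos not_le)
  then have "frob_norm p ?D = 0" by (simp add: frob_norm_def order_antisym)
  then show "A = B" unfolding frob_norm_eq_0_iff[OF p(1) D] by (simp add: fun_eq_iff)
qed

lemma inverse_norm_le:
  assumes p: "prime p" "5 \<le> p"
  shows "inverse_norm p (phi_star_c p) \<le> ennreal (2 * real (p - 1))"
  unfolding inverse_norm_def
proof (intro SUP_least ennreal_leI)
  fix F assume F: "F \<in> meas_map p (phi_star_c p) ` mat_space p - {\<lambda>_. 0}"
  let ?n = "real (p - 1)" and ?A = "inv_into (mat_space p) (meas_map p (phi_star_c p)) F"
  \<comment> \<open>The lower bound applies to whichever preimage \<open>inv_into\<close>
    returns.\<close>
  have MA: "meas_map p (phi_star_c p) ?A = F" using F f_inv_into_f[of F "meas_map p (phi_star_c p)" "mat_space p"] by blast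
  have "1 / (2 * ?n) * frob_norm p ?A \<le> norm_G p F"
    using meas_map_lower_bound[OF p(1), of ?A] mult_right_mono[OF lower_bound_constant_ge[OF p(2)], of "frob_norm p ?A"]
    unfolding MA by (simp add: frob_norm_def)
  then have le: "frob_norm p ?A \<le> 2 * ?n * norm_G p F" using p(2) by (simp add: field_simps)
  show "frob_norm p ?A / norm_G p F \<le> 2 * ?n"
  \<comment> \<open>In the zero case the quotient is 0 by the convention for division by
    zero.\<close>
  proof (cases "norm_G p F = 0")
    case False
    then have "norm_G p F > 0" by (simp add: order_less_le)
    with le show ?thesis by (simp add: divide_le_eq)
  qed simp
qed

section \<open>Existence of a minimiser by compactness\<close>

lemma continuous_on_l2norm:
  assumes "\<And>x. x \<in> X \<Longrightarrow> continuous_on S (\<lambda>f. F f x)"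
  shows "continuous_on S (\<lambda>f. l2norm X (F f))"
  unfolding l2norm_def L2_set_def using assms by (intro continuous_intros) auto

text \<open>In the product topology the sphere is a closed subset of a product of closed unit discs
  over \<open>X\<close> and of \<open>{0}\<close> elsewhere, which is compact by Tychonoff.\<close>

lemma compact_l2_sphere:
  assumes "finite X"
  shows "compact {f \<in> fun_space X. l2norm X f = 1}"
proof -
  let ?box = "PiE UNIV (\<lambda>x. if x \<in> X then cball 0 1 else {0}) :: ('a \<Rightarrow> complex) set"
  have "compactin (product_topology (\<lambda>_. euclidean) UNIV) ?box"
    unfolding compactin_PiE by auto
  then have box: "compact ?box"
    by (simp only: euclidean_product_topology compactin_euclidean_iff)
  have "continuous_on UNIV (\<lambda>f :: 'a \<Rightarrow> complex. l2norm X f)"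
    by (intro continuous_on_l2norm continuous_on_product_coordinates)
  then have "closed {f :: 'a \<Rightarrow> complex. l2norm X f = 1}"
    by (intro closed_Collect_eq continuous_on_const)
  from compact_Int_closed[OF box this]
  have "compact (?box \<inter> {f. l2norm X f = 1})" .
  also have "?box \<inter> {f. l2norm X f = 1} = {f \<in> fun_space X. l2norm X f = 1}"
  proof -
    have "cmod (f x) \<le> l2norm X f" if "x \<in> X" for f x
      unfolding l2norm_def using assms that by (rule member_le_L2_set)
    then have "f \<in> ?box" if "f \<in> fun_space X" "l2norm X f = 1" for f
      using that by (auto simp: fun_space_def PiE_iff) (metis that(2))
    moreover have "f \<in> fun_space X" if "f \<in> ?box" for f
    proof -
      have "f x = 0" if "x \<notin> X" for x using PiE_mem[OF \<open>f \<in> ?box\<close> UNIV_I, of x] that by simp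
      then show ?thesis by (simp add: fun_space_def)
    qed
    ultimately show ?thesis by blast
  qed
  finally show ?thesis .
qed

lemma ex_fun_space_nonzero:
  assumes "x \<in> X"
  shows "\<exists>f\<in>fun_space X. f \<noteq> (\<lambda>_. 0)"
  using assms by (intro bexI[of _ "\<lambda>y. of_bool (y = x)"]) (auto simp: fun_space_def fun_eq_iff)

text \<open>\<open>LEAST\<close> has the intended value only if the minimum is attained. By
  homogeneity every quotient is a value of the norm on the unit sphere, where a continuous function
  has a minimum.\<close>

lemma least_singular_value_attained:
  assumes p: "prime p"
  obtains A where "A \<in> mat_space p" "A \<noteq> (\<lambda>_. 0)"
    "least_singular_value p \<phi> = norm_G p (meas_map p \<phi> A) / frob_norm p A"
    "\<And>B. B \<in> mat_space p \<Longrightarrow> B \<noteq> (\<lambda>_. 0) \<Longrightarrow>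
       least_singular_value p \<phi> \<le> norm_G p (meas_map p \<phi> B) / frob_norm p B"
proof -
  let ?XX = "Fpx p \<times> Fpx p"
  let ?K = "{A \<in> mat_space p. l2norm ?XX A = 1}"
  let ?N = "\<lambda>A. norm_G p (meas_map p \<phi> A)"
  have "continuous_on ?K (\<lambda>A. meas_map p \<phi> A (k, l))" if "(k, l) \<in> carrier (affine_group p)" for k l
  proof -
    have kl: "k \<in> {0..<int p}" "l \<in> {1..int p - 1}" using that by (simp_all add: carrier_affine_group[OF p])
    show ?thesis
      unfolding meas_map_eq_sum[OF p kl]
      by (intro continuous_intros continuous_on_subset[OF continuous_on_product_coordinates]) auto
  qed
  then have cont: "continuous_on ?K ?N" by (intro continuous_on_l2norm) auto
  have normalize: "\<exists>A\<in>?K. ?N A = ?N B / frob_norm p B" if B: "B \<in> mat_space p" "B \<noteq> (\<lambda>_. 0)" for B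
  proof (intro bexI)
    let ?c = "1 / frob_norm p B" and ?A = "\<lambda>q. of_real (1 / frob_norm p B) * B q"
    have pos: "frob_norm p B > 0"
      using frob_norm_eq_0_iff[OF p B(1)] B(2) by (simp add: frob_norm_def order_less_le)
    have "?N ?A = l2norm (carrier (affine_group p)) (\<lambda>g. of_real ?c * meas_map p \<phi> B g)"
      by (simp only: meas_map_scale)
    then show "?N ?A = ?N B / frob_norm p B" using pos by (simp only: l2norm_scale) (simp add: norm_divide)
    have "l2norm ?XX ?A = 1" using pos by (simp only: l2norm_scale) (simp add: frob_norm_def norm_divide)
    then show "?A \<in> ?K" using B by (simp add: fun_space_def)
  qed
  have one: "1 \<in> Fpx p" using Fpx_eq[OF p] prime_gt_1_nat[OF p] by auto
  have "?K \<noteq> {}"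
    using ex_fun_space_nonzero[of "(1, 1)" ?XX] one normalize by blast
  then obtain A where A: "A \<in> ?K" "\<forall>B\<in>?K. ?N A \<le> ?N B"
    using continuous_attains_inf[OF _ _ cont] compact_l2_sphere[of ?XX] finite_Fpx[OF p] by blast
  have le: "?N A / frob_norm p A \<le> ?N B / frob_norm p B" if "B \<in> mat_space p" "B \<noteq> (\<lambda>_. 0)" for B
    using normalize[OF that] A by (auto simp: frob_norm_def)
  have A': "A \<in> mat_space p" "A \<noteq> (\<lambda>_. 0)" using A(1) by (auto simp: l2norm_def L2_set_def)
  have "least_singular_value p \<phi> = ?N A / frob_norm p A"
    unfolding least_singular_value_def using A' le by (intro Least_equality) auto
  with A' le that show ?thesis by simp
qed

section \<open>The alternating tent and the upper bound\<close>

lemma sum_sign: "(\<Sum>k<j. (-1) ^ k) = (if even j then 0 else 1 :: real)"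
  by (induction j) auto

text \<open>The tent vanishes at both ends, so twice the sum is the sum of consecutive pairs. Each
  pair is a sign given by the slope of the tent, and these signs almost cancel.\<close>

lemma tent_alternating_sum:
  "\<bar>\<Sum>k<2 * m. (-1) ^ k * real (min k (2 * m - k))\<bar> \<le> 1"
proof -
  let ?h = "\<lambda>k. (-1) ^ k * real (min k (2 * m - k))"
  have "2 * (\<Sum>k<2 * m. ?h k) = (\<Sum>k<2 * m. ?h (Suc k) + ?h k)"
  proof -
    have "(\<Sum>k<2 * m. ?h (Suc k)) = (\<Sum>k<Suc (2 * m). ?h k)"
      by (subst sum.lessThan_Suc_shift) simp
    also have "\<dots> = (\<Sum>k<2 * m. ?h k)" by simp
    finally show ?thesis by (simp only: sum.distrib mult_2)
  qed
  also have "\<dots> = (\<Sum>k<2 * m. (-1) ^ k - 2 * (if k < m then (-1) ^ k else 0))"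
  proof (intro sum.cong refl)
    fix k assume "k \<in> {..<2 * m}"
    then show "?h (Suc k) + ?h k = (-1) ^ k - 2 * (if k < m then (-1) ^ k else 0)"
      by (cases "k < m") (auto simp: min_def of_nat_diff algebra_simps)
  qed
  also have "\<dots> = - 2 * (\<Sum>k<m. (-1) ^ k)"
  proof -
    have "{..<2 * m} \<inter> {k. k < m} = {..<m}" by auto
    then show ?thesis by (simp add: sum_subtractf sum_sign sum.If_cases flip: sum_distrib_left)
  qed
  finally show ?thesis by (simp add: sum_sign split: if_splits)
qed

text \<open>Prefix sums by induction, first up the rising half and then down the falling one, where
  the height at \<open>m + j\<close> is \<open>m - j\<close>.\<close>

lemma tent_sum_squares:
  "(\<Sum>k<2 * m. (real (min k (2 * m - k)))\<^sup>2) = real m * (2 * (real m)\<^sup>2 + 1) / 3"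
proof -
  let ?h = "\<lambda>k. (real (min k (2 * m - k)))\<^sup>2"
  have up: "j \<le> m \<Longrightarrow> (\<Sum>k<j. ?h k) = (real j - 1) * real j * (2 * real j - 1) / 6" for j
    by (induction j) (auto simp: power2_eq_square field_simps)
  have down: "j \<le> m \<Longrightarrow> (\<Sum>k<m + j. ?h k) = (real m - 1) * real m * (2 * real m - 1) / 6
     + j * (real m)\<^sup>2 - m * j * (real j - 1) + (real j - 1) * real j * (2 * real j - 1) / 6" for j
  proof (induction j)
    case 0
    show ?case using up[of m] by simp
  next
    case (Suc j)
    then have "min (m + j) (2 * m - (m + j)) = m - j" by auto
    with Suc.prems have "?h (m + j) = (real m - real j)\<^sup>2" by (simp add: of_nat_diff)
    with Suc show ?case by (simp add: power2_eq_square) (simp add: field_simps)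
  qed
  have "{..<2 * m} = {..<m + m}" by auto
  then show ?thesis using down[of m] by (simp only:) (simp add: power2_eq_square field_simps)
qed

text \<open>A piecewise linear replacement for \<open>(-1) ^ k * sin (pi * k / n)\<close>, the
  equality case of the path bound, placed on the diagonal \<open>t = 1\<close>. Alternating signs
  make the incidence sums equal to plus or minus the slope.\<close>

definition tent :: "nat \<Rightarrow> int \<times> int \<Rightarrow> complex" where
  "tent p q = (if q \<in> {1..int p - 1} \<times> {1..int p - 1} \<and> snd q = fst q + 1
     then of_real ((-1) ^ nat (fst q) * real (min (nat (fst q)) (p - 1 - nat (fst q)))) else 0)"

lemma path_coeff_tent:
  assumes k: "k \<le> p - 1"
  shows "path_coeff p (tent p) 1 k = of_real ((-1) ^ k * real (min k (p - 1 - k)))"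
proof (cases "k \<in> {1..<p - 1}")
  case True
  then have "1 * int k mod int p = int k" "1 * (int k + 1) mod int p = int k + 1" by auto
  then show ?thesis using True by (auto simp: path_coeff_def tent_def)
qed (use k in \<open>auto simp: path_coeff_def\<close>)

lemma tent_offdiagonal: "q \<in> diag p t \<Longrightarrow> t \<noteq> 1 \<Longrightarrow> tent p q = 0"
  by (auto simp: diag_def tent_def)

lemma tent_upper_bound:
  fixes p :: nat and n :: real
  defines "n \<equiv> real (p - 1)"
  assumes p: "prime p" "5 \<le> p"
  shows "norm_G p (meas_map p (phi_star_c p) (tent p))
    \<le> pi * sqrt (5 * real p / 2) / (2 * n * (sqrt n + 1)) * frob_norm p (tent p)"
proof -
  \<comment> \<open>An even \<open>n = 2 * m\<close> puts the top of the tent at the integer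
    \<open>m\<close>.\<close>
  have "odd p" using p by (intro prime_odd_nat) auto
  then obtain m where m: "p = 2 * m + 1" by (rule oddE)
  then have pm: "p - 1 = 2 * m" by simp
  have n: "n \<ge> 4" using p by (simp add: n_def)
  have nm: "n = 2 * real m" unfolding n_def pm by simp
  have one: "1 \<in> {1..int p - 1}" using p by auto
  let ?a = "path_coeff p (tent p) 1"
  let ?h = "\<lambda>k. (-1) ^ k * real (min k (2 * m - k))"
  have a: "?a k = of_real (?h k)" if "k \<le> 2 * m" for k using path_coeff_tent[of k p] that pm by simp
  have only1: "(\<Sum>t\<in>{0..<int p}. f t) = f 1" if "\<And>t. t \<noteq> 1 \<Longrightarrow> f t = 0" for f :: "int \<Rightarrow> real"
    using that one by (subst sum.remove[of _ 1]) (auto intro!: sum.neutral)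
  have F: "(frob_norm p (tent p))\<^sup>2 \<ge> n ^ 3 / 12"
  proof -
    have "(frob_norm p (tent p))\<^sup>2 = (\<Sum>q\<in>diag p 1. (cmod (tent p q))\<^sup>2)"
      unfolding frob_norm_power2[OF p(1)] by (intro only1 sum.neutral) (auto simp: tent_offdiagonal)
    also have "\<dots> = (\<Sum>k<2 * m. (cmod (?a k))\<^sup>2)"
      unfolding sum_diag_path_coeff[OF p(1) one] pm ..
    also have "\<dots> = (\<Sum>k<2 * m. (real (min k (2 * m - k)))\<^sup>2)"
      by (intro sum.cong refl) (simp add: a norm_mult norm_power)
    also have "\<dots> = n * (n\<^sup>2 + 2) / 12"
      unfolding tent_sum_squares nm by (simp add: power2_eq_square)
    also have "\<dots> \<ge> n ^ 3 / 12" using n by (simp add: power2_eq_square power3_eq_cube algebra_simps)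
    finally show ?thesis .
  qed
  have edge: "(cmod (?a (Suc k) + ?a k))\<^sup>2 = 1" if "k < 2 * m" for k
  proof -
    have "?h (Suc k) + ?h k = (-1) ^ k \<or> ?h (Suc k) + ?h k = - ((-1) ^ k)"
      using that by (cases "k < m") (auto simp: min_def of_nat_diff algebra_simps)
    then have "(?h (Suc k) + ?h k)\<^sup>2 = 1" by (auto simp: power_mult[symmetric] mult.commute)
    moreover have "?a (Suc k) + ?a k = of_real (?h (Suc k) + ?h k)"
      using that by (simp only: a of_real_add less_imp_le_nat Suc_leI)
    ultimately show ?thesis by (simp only: norm_of_real power2_abs)
  qed
  have S: "(cmod (\<Sum>k<2 * m. ?a k))\<^sup>2 \<le> 1"
  proof -
    have "(\<Sum>k<2 * m. ?a k) = of_real (\<Sum>k<2 * m. ?h k)"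
      unfolding of_real_sum by (intro sum.cong refl) (simp add: a del: of_real_mult)
    then show ?thesis using tent_alternating_sum[of m] by (simp only: norm_of_real abs_square_le_1 abs_idempotent)
  qed
  have "(norm_G p (meas_map p (phi_star_c p) (tent p)))\<^sup>2 = p * diag_energy p (tent p) 1"
    unfolding norm_G_meas_map_power2[OF p(1)]
    by (subst only1) (auto simp: tent_offdiagonal)
  also have "diag_energy p (tent p) 1 = (1 / (2 * (sqrt n + 1)))\<^sup>2 *
      (n + (1 + 4 / sqrt n) * (cmod (\<Sum>k<2 * m. ?a k))\<^sup>2)"
    unfolding diag_energy_offdiagonal[OF p(1) one] pm by (simp add: edge nm)
  \<comment> \<open>\<open>n \<ge> 4\<close> gives \<open>sqrt n \<ge> 2\<close>, hence
    \<open>1 + 4 / sqrt n \<le> 3\<close>.\<close>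
  also have "p * \<dots> \<le> p * ((1 / (2 * (sqrt n + 1)))\<^sup>2 * (n + 3 * 1))"
  proof -
    have "2 \<le> sqrt n" using n by (intro real_le_rsqrt) auto
    moreover have "1 + 4 / s \<le> 3" if "2 \<le> s" for s :: real
      using that by (simp add: field_simps)
    ultimately have "1 + 4 / sqrt n \<le> 3" by blast
    then have "(1 + 4 / sqrt n) * (cmod (\<Sum>k<2 * m. ?a k))\<^sup>2 \<le> 3 * 1"
      using S by (intro mult_mono) auto
    then show ?thesis by (intro mult_left_mono add_left_mono) auto
  qed
  \<comment> \<open>With \<open>pi\<^sup>2 \<ge> 9\<close> it suffices that
    \<open>n + 3 \<le> 15 * n / 8\<close>, which holds from \<open>n = 4\<close> on. The factor
    \<open>5 / 24\<close> is \<open>5 / 2\<close> over the 12 in the bound for the Frobenius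
    norm.\<close>
  also have "\<dots> \<le> p * ((1 / (2 * (sqrt n + 1)))\<^sup>2 * (pi\<^sup>2 * (5 / 2) / n\<^sup>2 * (n ^ 3 / 12)))"
  proof -
    have "3 * 3 \<le> pi * pi" using pi_gt3 by (intro mult_mono) auto
    then have "9 * n \<le> pi\<^sup>2 * n" using n by (intro mult_right_mono) (auto simp: power2_eq_square)
    then have "n + 3 * 1 \<le> pi\<^sup>2 * n * (5 / 24)" using n by linarith
    also have "\<dots> = pi\<^sup>2 * (5 / 2) / n\<^sup>2 * (n ^ 3 / 12)"
      using n by (simp add: power2_eq_square power3_eq_cube)
    finally show ?thesis by (intro mult_left_mono) auto
  qed
  also have "\<dots> \<le> p * ((1 / (2 * (sqrt n + 1)))\<^sup>2 * (pi\<^sup>2 * (5 / 2) / n\<^sup>2 * (frob_norm p (tent p))\<^sup>2))"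
    using F by (intro mult_left_mono) auto
  also have "\<dots> = (pi * sqrt (5 * real p / 2) / (2 * n * (sqrt n + 1)) * frob_norm p (tent p))\<^sup>2"
  proof -
    have "real p * ((1 / (2 * y))\<^sup>2 * (pi\<^sup>2 * (5 / 2) / n\<^sup>2 * f\<^sup>2)) =
        (pi * sqrt (5 * real p / 2) / (2 * n * y) * f)\<^sup>2" for y f
      by (simp add: power_mult_distrib power_divide mult.commute)
    then show ?thesis .
  qed
  finally show ?thesis
    using n by (elim power2_le_imp_le) (auto simp: frob_norm_def)
qed

lemma tent_mat_space: "prime p \<Longrightarrow> tent p \<in> mat_space p"
  by (auto simp: fun_space_def tent_def Fpx_eq)

lemma tent_nonzero:
  assumes "5 \<le> p"
  shows "tent p \<noteq> (\<lambda>_. 0)"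
proof -
  have "tent p (1, 2) \<noteq> 0" using assms by (simp add: tent_def)
  then show ?thesis by auto
qed

section \<open>Two-sided order of the least singular value\<close>

lemma least_singular_value_phi_star_bounds:
  fixes p :: nat and d :: real
  defines "d \<equiv> real (p - 1)"
  assumes p: "prime p" "5 \<le> p"
  shows "1 / 2 * (1 / d) \<le> least_singular_value p (phi_star_c p)"
    and "least_singular_value p (phi_star_c p) \<le> pi * sqrt (5 / 2) * (1 / d)"
proof -
  let ?N = "\<lambda>A. norm_G p (meas_map p (phi_star_c p) A)"
  have d: "d \<ge> 4" using p by (simp add: d_def)
  have pos: "frob_norm p A > 0" if "A \<in> mat_space p" "A \<noteq> (\<lambda>_. 0)" for A
    using frob_norm_eq_0_iff[OF p(1) that(1)] that(2) by (simp add: frob_norm_def order_less_le)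
  obtain A where A: "A \<in> mat_space p" "A \<noteq> (\<lambda>_. 0)"
    "least_singular_value p (phi_star_c p) = ?N A / frob_norm p A"
    and le: "\<And>B. B \<in> mat_space p \<Longrightarrow> B \<noteq> (\<lambda>_. 0) \<Longrightarrow>
       least_singular_value p (phi_star_c p) \<le> ?N B / frob_norm p B"
    using least_singular_value_attained[OF p(1), of "phi_star_c p"] by metis
  have "1 / (2 * d) * frob_norm p A \<le> ?N A"
    using meas_map_lower_bound[OF p(1), of A] mult_right_mono[OF lower_bound_constant_ge[OF p(2)], of "frob_norm p A"]
    unfolding d_def by (simp add: frob_norm_def)
  then show "1 / 2 * (1 / d) \<le> least_singular_value p (phi_star_c p)"
    using pos[OF A(1,2)] unfolding A(3) by (simp add: le_divide_eq)
  have "?N (tent p) / frob_norm p (tent p) \<le> pi * sqrt (5 * real p / 2) / (2 * d * (sqrt d + 1))"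
    using tent_upper_bound[OF p] pos[OF tent_mat_space[OF p(1)] tent_nonzero[OF p(2)]]
    unfolding d_def by (simp add: divide_le_eq)
  also have "\<dots> = pi * sqrt (5 / 2) * (1 / d) * (sqrt p / (2 * (sqrt d + 1)))"
  proof -
    have "sqrt (5 * real p / 2) = sqrt (5 / 2) * sqrt p" by (simp flip: real_sqrt_mult)
    moreover have "pi * (u * v) / (2 * d * s) = pi * u * (1 / d) * (v / (2 * s))" for u v s by simp
    ultimately show ?thesis by (simp only:)
  qed
  \<comment> \<open>Since \<open>p = d + 1\<close>, subadditivity of the square root gives
    \<open>sqrt p \<le> sqrt d + 1\<close>, so the last factor is at most 1.\<close>
  also have "\<dots> \<le> pi * sqrt (5 / 2) * (1 / d) * 1"
  proof (intro mult_left_mono)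
    have "sqrt p \<le> sqrt d + sqrt 1"
      using p by (intro order_trans[OF _ sqrt_add_le_add_sqrt]) (auto simp: d_def)
    moreover have "x / (2 * (y + 1)) \<le> 1" if "x \<le> y + sqrt 1" "0 \<le> y" for x y :: real
      using that by (simp add: divide_le_eq)
    moreover have "0 \<le> sqrt d" using d by simp
    ultimately show "sqrt p / (2 * (sqrt d + 1)) \<le> 1" by blast
  qed (use d in auto)
  finally show "least_singular_value p (phi_star_c p) \<le> pi * sqrt (5 / 2) * (1 / d)"
    using le[OF tent_mat_space[OF p(1)] tent_nonzero[OF p(2)]] by simp
qed

theorem theorem5p2:
  shows
    "(\<forall>p::nat. prime p \<and> 5 \<le> p \<longrightarrow>
       (let n = real (p - 1); d = n in
         (\<forall>A \<in> mat_space p.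
            norm_G p (meas_map p (phi_star_c p) A)
              \<ge> sqrt (real p) / (sqrt n + 1) * sin (pi / (2 * n)) * frob_norm p A) \<and>
         inj_on (meas_map p (phi_star_c p)) (mat_space p) \<and>
         inverse_norm p (phi_star_c p) \<le> ennreal (2 * d) \<and>
         (\<exists>A \<in> mat_space p. A \<noteq> (\<lambda>_. 0) \<and>
            norm_G p (meas_map p (phi_star_c p) A)
              \<le> pi * sqrt (5 * real p / 2) / (2 * n * (sqrt n + 1)) * frob_norm p A))) \<and>
     (\<exists>c>0::real. \<exists>C>0::real. \<forall>p::nat. prime p \<and> 5 \<le> p \<longrightarrow>
       (let d = real (p - 1) in
         c * (1 / d) \<le> least_singular_value p (phi_star_c p) \<and>
         least_singular_value p (phi_star_c p) \<le> C * (1 / d)))"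
  (is "?bounds \<and> ?order")
proof
  show ?bounds
    unfolding Let_def
    using meas_map_lower_bound inj_on_meas_map_phi_star inverse_norm_le
      tent_upper_bound tent_mat_space tent_nonzero by blast
  have "(0::real) < 1 / 2" "0 < pi * sqrt (5 / 2)" by auto
  with least_singular_value_phi_star_bounds show ?order
    unfolding Let_def by blast
qed

end
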